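(* Let $v>0$, $c>0$ be constants with $\frac vc>\sqrt2$, and let $s\in\mathbb{R}$. There exists a constant $C>0$ such that for all $\gamma\ge1$ and all $f\in H^{s+2}_\gamma(\mathbb{R}^2)$, if $g\in H^s_\gamma(\mathbb{R}^2)$ is the function defined by $$\Sigma(\tau,\eta)\,\widehat f=\widehat g,\qquad \tau=\gamma+i\delta,\ (\delta,\eta)\in\mathbb{R}^2,$$ then $$\gamma\,\|f\|_{H^{s+1}_\gamma(\mathbb{R}^2)}\le C\,\|g\|_{H^s_\gamma(\mathbb{R}^2)} .$$
   Context: For $\Re\tau>0$ and $\eta\in\mathbb{R}$, $\mu^\pm=\mu^\pm(\tau,\eta)$ denotes the square root of $\left(\frac{\tau\pm iv\eta}{c}\right)^2+\eta^2$ with $\Re\mu^\pm>0$, and $$\Sigma(\tau,\eta)=\tau^2+v^2\eta^2\left(8\left(\frac{\tau/c}{\mu^+(\tau,\eta)+\mu^-(\tau,\eta)}\right)^2-1\right).$$ Weighted spaces: points of $\mathbb{R}^2$ are $(t,x_1)$, with Fourier dual variables $(\delta,\eta)$, and $\tau=\gamma+i\delta$. For $s\in\mathbb{R}$, $\gamma\ge1$, set $\|u\|_{s,\gamma}^2=\frac1{(2\pi)^2}\iint_{\mathbb{R}^2}(\gamma^2+\delta^2+\eta^2)^s|\widehat u(\delta,\eta)|^2\,d\delta\,d\eta$, where here $\widehat u$ is the Fourier transform of $u$; $H^s_\gamma(\mathbb{R}^2)=\{u\in\mathcal D'(\mathbb{R}^2): e^{-\gamma t}u\in H^s(\mathbb{R}^2)\}$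 with norm $\|u\|_{H^s_\gamma(\mathbb{R}^2)}=\|e^{-\gamma t}u\|_{s,\gamma}$. In the equation $\Sigma\widehat f=\widehat g$, the symbols $\widehat f,\widehat g$ denote the Fourier transforms in $(t,x_1)$ of $e^{-\gamma t}f$ and $e^{-\gamma t}g$, and the equality is meant for almost every $(\delta,\eta)$. *)

theory Defs
  imports "HOL-Analysis.Analysis"
begin

section \<open>Smooth functions, test functions, Schwartz functions\<close>

text \<open>The list \<open>[b\<^sub>1, \<dots>, b\<^sub>k]\<close> of basis vectors stands for the partial derivative
  \<open>\<partial>\<^bsub>b\<^sub>1\<^esub> \<dots> \<partial>\<^bsub>b\<^sub>k\<^esub>\<close>; all orders of differentiation are listed, so no
  multi-index bookkeeping is needed.\<close>

primrec partials :: "'a::euclidean_space list \<Rightarrow> ('a \<Rightarrow> complex) \<Rightarrow> 'a \<Rightarrow> complex" where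
  "partials [] \<phi> = \<phi>"
| "partials (b # bs) \<phi> = (\<lambda>x. frechet_derivative (partials bs \<phi>) (at x) b)"

definition smooth :: "('a::euclidean_space \<Rightarrow> complex) \<Rightarrow> bool" where
  "smooth \<phi> \<longleftrightarrow> (\<forall>bs\<in>lists Basis. partials bs \<phi> differentiable_on UNIV)"

definition supp :: "('a::euclidean_space \<Rightarrow> complex) \<Rightarrow> 'a set" where
  "supp \<phi> = closure {x. \<phi> x \<noteq> 0}"

definition test_functions :: "('a::euclidean_space \<Rightarrow> complex) set" where
  "test_functions = {\<phi>. smooth \<phi> \<and> compact (supp \<phi>)}"

definition schwartz_functions :: "('a::euclidean_space \<Rightarrow> complex) set" where
  "schwartz_functions = {\<phi>. smooth \<phi> \<and>
     (\<forall>N. \<forall>bs\<in>lists Basis. bounded (range (\<lambda>x. (1 + norm x) ^ N *\<^sub>R partials bs \<phi> x)))}"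


section \<open>Distributions and tempered distributions\<close>

definition linear_functional_on ::
    "('a \<Rightarrow> complex) set \<Rightarrow> (('a \<Rightarrow> complex) \<Rightarrow> complex) \<Rightarrow> bool" where
  "linear_functional_on V u \<longleftrightarrow>
     (\<forall>\<phi>\<in>V. \<forall>\<psi>\<in>V. u (\<lambda>x. \<phi> x + \<psi> x) = u \<phi> + u \<psi>) \<and>
     (\<forall>a. \<forall>\<phi>\<in>V. u (\<lambda>x. a * \<phi> x) = a * u \<phi>)"

text \<open>Continuity is expressed by the usual seminorm estimates.  Functionals are
  \<^const>\<open>extensional\<close>, so that equality of functionals is equality on the space
  of test (resp. Schwartz) functions.\<close>

definition distributions :: "(('a::euclidean_space \<Rightarrow> complex) \<Rightarrow> complex) set" where
  "distributions = {u \<in> extensional test_functions.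
     linear_functional_on test_functions u \<and>
     (\<forall>K. compact K \<longrightarrow> (\<exists>C N. \<forall>\<phi>\<in>test_functions. supp \<phi> \<subseteq> K \<longrightarrow>
        norm (u \<phi>) \<le> C * (\<Sum>bs | bs \<in> lists Basis \<and> length bs \<le> N.
                              SUP x. norm (partials bs \<phi> x))))}"

definition tempered_distributions :: "(('a::euclidean_space \<Rightarrow> complex) \<Rightarrow> complex) set" where
  "tempered_distributions = {U \<in> extensional schwartz_functions.
     linear_functional_on schwartz_functions U \<and>
     (\<exists>C N. \<forall>\<phi>\<in>schwartz_functions.
        norm (U \<phi>) \<le> C * (\<Sum>bs | bs \<in> lists Basis \<and> length bs \<le> N.
                              SUP x. (1 + norm x) ^ N * norm (partials bs \<phi> x)))}"

text \<open>Product of a distribution with a smooth function \<open>a\<close>.\<close>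

definition mult_distribution ::
    "('a::euclidean_space \<Rightarrow> complex) \<Rightarrow> (('a \<Rightarrow> complex) \<Rightarrow> complex) \<Rightarrow> (('a \<Rightarrow> complex) \<Rightarrow> complex)" where
  "mult_distribution a u = (\<lambda>\<phi>\<in>test_functions. u (\<lambda>x. a x * \<phi> x))"

text \<open>A distribution is tempered if it extends to a tempered distribution; the extension is
  unique because test functions are dense in the Schwartz space.\<close>

definition extends_distribution ::
    "(('a::euclidean_space \<Rightarrow> complex) \<Rightarrow> complex) \<Rightarrow> (('a \<Rightarrow> complex) \<Rightarrow> complex) \<Rightarrow> bool" where
  "extends_distribution U u \<longleftrightarrow> (\<forall>\<phi>\<in>test_functions. U \<phi> = u \<phi>)"

definition tempered :: "(('a::euclidean_space \<Rightarrow> complex) \<Rightarrow> complex) \<Rightarrow> bool" where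
  "tempered u \<longleftrightarrow> (\<exists>U\<in>tempered_distributions. extends_distribution U u)"

definition tempered_extension ::
    "(('a::euclidean_space \<Rightarrow> complex) \<Rightarrow> complex) \<Rightarrow> (('a \<Rightarrow> complex) \<Rightarrow> complex)" where
  "tempered_extension u = (THE U. U \<in> tempered_distributions \<and> extends_distribution U u)"


section \<open>Fourier transform and Sobolev spaces\<close>

definition fourier :: "('a::euclidean_space \<Rightarrow> complex) \<Rightarrow> 'a \<Rightarrow> complex" where
  "fourier \<phi> \<xi> = (LINT x|lborel. exp (- \<i> * complex_of_real (x \<bullet> \<xi>)) * \<phi> x)"

definition fourier_tempered ::
    "(('a::euclidean_space \<Rightarrow> complex) \<Rightarrow> complex) \<Rightarrow> (('a \<Rightarrow> complex) \<Rightarrow> complex)" where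
  "fourier_tempered U = (\<lambda>\<phi>\<in>schwartz_functions. U (fourier \<phi>))"

definition locally_integrable :: "('a::euclidean_space \<Rightarrow> complex) \<Rightarrow> bool" where
  "locally_integrable h \<longleftrightarrow> (\<forall>K. compact K \<longrightarrow> set_integrable lborel K h)"

definition represented_by ::
    "(('a::euclidean_space \<Rightarrow> complex) \<Rightarrow> complex) \<Rightarrow> ('a \<Rightarrow> complex) \<Rightarrow> bool" where
  "represented_by T h \<longleftrightarrow> locally_integrable h \<and>
     (\<forall>\<phi>\<in>test_functions. T \<phi> = (LINT \<xi>|lborel. h \<xi> * \<phi> \<xi>))"

text \<open>When the Fourier transform of \<open>U\<close> is a function, that function is determined
  almost everywhere; a representative is chosen.\<close>

definition fourier_fun ::
    "(('a::euclidean_space \<Rightarrow> complex) \<Rightarrow> complex) \<Rightarrow> 'a \<Rightarrow> complex" where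
  "fourier_fun U = (SOME h. represented_by (fourier_tempered U) h)"

definition sobolev :: "real \<Rightarrow> (('a::euclidean_space \<Rightarrow> complex) \<Rightarrow> complex) set" where
  "sobolev s = {U \<in> tempered_distributions.
     (\<exists>h. represented_by (fourier_tempered U) h) \<and>
     integrable lborel (\<lambda>\<xi>. (1 + (norm \<xi>)\<^sup>2) powr s * (norm (fourier_fun U \<xi>))\<^sup>2)}"


section \<open>Weighted spaces on \<open>\<real>\<^sup>2\<close>\<close>

text \<open>Points of \<open>\<real>\<^sup>2\<close> are \<open>(t, x\<^sub>1)\<close>, with dual variables \<open>(\<delta>, \<eta>)\<close>.\<close>

type_synonym functional2 = "(real \<times> real \<Rightarrow> complex) \<Rightarrow> complex"

definition norm_s_gamma :: "real \<Rightarrow> real \<Rightarrow> functional2 \<Rightarrow> real" where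
  "norm_s_gamma s \<gamma> U = sqrt (1 / (2 * pi)\<^sup>2 *
     (LINT (\<delta>, \<eta>)|lborel. (\<gamma>\<^sup>2 + \<delta>\<^sup>2 + \<eta>\<^sup>2) powr s * (norm (fourier_fun U (\<delta>, \<eta>)))\<^sup>2))"

definition exp_weight :: "real \<Rightarrow> functional2 \<Rightarrow> functional2" where
  "exp_weight \<gamma> u = mult_distribution (\<lambda>(t, x\<^sub>1). complex_of_real (exp (- \<gamma> * t))) u"

definition H_gamma :: "real \<Rightarrow> real \<Rightarrow> functional2 set" where
  "H_gamma s \<gamma> = {u \<in> distributions.
     tempered (exp_weight \<gamma> u) \<and> tempered_extension (exp_weight \<gamma> u) \<in> sobolev s}"

definition H_gamma_norm :: "real \<Rightarrow> real \<Rightarrow> functional2 \<Rightarrow> real" where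
  "H_gamma_norm s \<gamma> u = norm_s_gamma s \<gamma> (tempered_extension (exp_weight \<gamma> u))"

text \<open>The Fourier transform in \<open>(t, x\<^sub>1)\<close> of \<open>e\<^sup>-\<^sup>\<gamma>\<^sup>t u\<close>.\<close>

definition weighted_hat :: "real \<Rightarrow> functional2 \<Rightarrow> real \<times> real \<Rightarrow> complex" where
  "weighted_hat \<gamma> u = fourier_fun (tempered_extension (exp_weight \<gamma> u))"


section \<open>The symbol\<close>

definition mu_plus :: "real \<Rightarrow> real \<Rightarrow> complex \<Rightarrow> real \<Rightarrow> complex" where
  "mu_plus v c \<tau> \<eta> = (THE w. w\<^sup>2 = ((\<tau> + \<i> * of_real v * of_real \<eta>) / of_real c)\<^sup>2 + (of_real \<eta>)\<^sup>2
                              \<and> Re w > 0)"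

definition mu_minus :: "real \<Rightarrow> real \<Rightarrow> complex \<Rightarrow> real \<Rightarrow> complex" where
  "mu_minus v c \<tau> \<eta> = (THE w. w\<^sup>2 = ((\<tau> - \<i> * of_real v * of_real \<eta>) / of_real c)\<^sup>2 + (of_real \<eta>)\<^sup>2
                               \<and> Re w > 0)"

definition Sigma_symbol :: "real \<Rightarrow> real \<Rightarrow> complex \<Rightarrow> real \<Rightarrow> complex" where
  "Sigma_symbol v c \<tau> \<eta> = \<tau>\<^sup>2 + (of_real v)\<^sup>2 * (of_real \<eta>)\<^sup>2 *
     (8 * ((\<tau> / of_real c) / (mu_plus v c \<tau> \<eta> + mu_minus v c \<tau> \<eta>))\<^sup>2 - 1)"

end

theory Submission imports Defs
begin

text \<open>Put \<open>z = \<tau> / c\<close>, \<open>M = v / c\<close>. From \<open>(\<mu>\<^sup>+)\<^sup>2 - (\<mu>\<^sup>-)\<^sup>2 = 4 i M z \<eta>\<close> the symbol collapses to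
  \<open>\<Sigma> = c\<^sup>2 (\<mu>\<^sup>+ \<mu>\<^sup>- - \<eta>\<^sup>2)\<close>. Multiplying by the conjugate factor removes the square roots:
  \<open>(\<mu>\<^sup>+ \<mu>\<^sup>- - \<eta>\<^sup>2) (\<mu>\<^sup>+ \<mu>\<^sup>- + \<eta>\<^sup>2) = (z\<^sup>2 + a\<^sup>2 \<eta>\<^sup>2) (z\<^sup>2 + b\<^sup>2 \<eta>\<^sup>2)\<close>, where
  \<open>a\<^sup>2, b\<^sup>2 = M\<^sup>2 + 1 \<mp> sqrt (4 M\<^sup>2 + 1)\<close> are positive and distinct because \<open>M > sqrt 2\<close>. So the four
  roots in \<open>z\<close> are simple and purely imaginary: at most one linear factor is small, and that one is
  at least \<open>Re z\<close>. Since the conjugate factor is at most quadratic, \<open>\<bar>\<Sigma>\<bar>\<close> is bounded below by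
  \<open>\<gamma> (\<bar>\<tau>\<bar> + \<bar>\<eta>\<bar>)\<close>, and the estimate follows by integrating over the Fourier side.\<close>

section \<open>The square roots and the reduced form of the symbol\<close>

text \<open>\<open>csqrt\<close> has nonnegative real part, and a purely imaginary root would make
  \<open>z\<close> minus a real square. Both \<open>THE\<close> descriptions of the roots rest on
  this.\<close>

lemma ex1_sqrt_Re_pos:
  fixes z :: complex
  assumes "z \<notin> \<real>\<^sub>\<le>\<^sub>0"
  shows "\<exists>!w. w\<^sup>2 = z \<and> Re w > 0"
proof (rule ex1I[of _ "csqrt z"])
  have "Re (csqrt z) \<noteq> 0"
  proof
    assume "Re (csqrt z) = 0"
    then have "z = of_real (- (Im (csqrt z))\<^sup>2)"
      by (subst power2_csqrt[symmetric], subst complex_eq_iff) (simp add: power2_eq_square)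
    then have "z \<in> \<real>\<^sub>\<le>\<^sub>0"
      by (metis nonpos_Reals_of_real_iff neg_le_0_iff_le zero_le_power2)
    with assms show False by simp
  qed
  then show "(csqrt z)\<^sup>2 = z \<and> Re (csqrt z) > 0"
    using csqrt_principal[of z] by auto
next
  fix w assume "w\<^sup>2 = z \<and> Re w > 0"
  then show "w = csqrt z" using csqrt_square[of w] by auto
qed

text \<open>A real value forces \<open>2 * Re z * Im z = 0\<close>, so \<open>z\<close> is real and
  the sum of squares is positive.\<close>

lemma square_plus_square_notin_nonpos_Reals:
  fixes z :: complex and y :: real
  assumes "Re z > 0"
  shows "z\<^sup>2 + (of_real y)\<^sup>2 \<notin> \<real>\<^sub>\<le>\<^sub>0"
proof
  assume *: "z\<^sup>2 + (of_real y)\<^sup>2 \<in> \<real>\<^sub>\<le>\<^sub>0"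
  then have "Im z = 0" using assms
    by (simp add: complex_nonpos_Reals_iff power2_eq_square)
  with * have "Re z * Re z + y * y \<le> 0"
    by (simp add: complex_nonpos_Reals_iff power2_eq_square)
  moreover have "Re z * Re z > 0" using assms by simp
  ultimately show False by (smt (verit) zero_le_square)
qed

lemma mu_plus_props:
  assumes "Re \<tau> > 0" "c > 0"
  shows "(mu_plus v c \<tau> \<eta>)\<^sup>2 = ((\<tau> + \<i> * of_real v * of_real \<eta>) / of_real c)\<^sup>2 + (of_real \<eta>)\<^sup>2"
    and "Re (mu_plus v c \<tau> \<eta>) > 0"
proof -
  have "Re ((\<tau> + \<i> * of_real v * of_real \<eta>) / of_real c) > 0"
    using assms by (simp add: Re_divide_of_real)
  from theI'[OF ex1_sqrt_Re_pos[OF square_plus_square_notin_nonpos_Reals[OF this]]]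
  show "(mu_plus v c \<tau> \<eta>)\<^sup>2 = ((\<tau> + \<i> * of_real v * of_real \<eta>) / of_real c)\<^sup>2 + (of_real \<eta>)\<^sup>2"
    and "Re (mu_plus v c \<tau> \<eta>) > 0"
    unfolding mu_plus_def by auto
qed

text \<open>Facts on \<open>mu_plus\<close> hold for \<open>v\<close> of either sign, so they
  transfer to \<open>mu_minus\<close>.\<close>

lemma mu_minus_eq_mu_plus: "mu_minus v c \<tau> \<eta> = mu_plus (- v) c \<tau> \<eta>"
  by (simp add: mu_minus_def mu_plus_def)

text \<open>With \<open>p\<close>, \<open>m\<close> the two roots, the term
  \<open>8 * M\<^sup>2 * e\<^sup>2 * z\<^sup>2\<close> equals
  \<open>- (p\<^sup>2 - m\<^sup>2)\<^sup>2 / 2\<close>, so division by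
  \<open>(p + m)\<^sup>2\<close> leaves \<open>- (p - m)\<^sup>2 / 2\<close>. The remaining part is
  \<open>(p\<^sup>2 + m\<^sup>2) / 2 - e\<^sup>2\<close>, and the two add up to
  \<open>p * m - e\<^sup>2\<close>.\<close>

lemma Sigma_symbol_eq:
  assumes "Re \<tau> > 0" "c > 0"
  shows "Sigma_symbol v c \<tau> \<eta> =
    (of_real c)\<^sup>2 * (mu_plus v c \<tau> \<eta> * mu_minus v c \<tau> \<eta> - (of_real \<eta>)\<^sup>2)"
proof -
  define z M e p m C where "z = \<tau> / of_real c" and "M = (of_real (v / c) :: complex)"
    and "e = (of_real \<eta> :: complex)" and "p = mu_plus v c \<tau> \<eta>" and "m = mu_minus v c \<tau> \<eta>"
    and "C = (of_real c :: complex)"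
  have C: "C \<noteq> 0" using assms by (simp add: C_def)
  have \<tau>: "\<tau> = C * z" and v: "of_real v = C * M"
    using C by (simp_all add: z_def M_def C_def)
  have p: "p\<^sup>2 = (z + \<i> * M * e)\<^sup>2 + e\<^sup>2"
    using mu_plus_props(1)[OF assms, of v \<eta>] C
    by (simp add: p_def e_def z_def M_def C_def add_divide_distrib)
  have m: "m\<^sup>2 = (z - \<i> * M * e)\<^sup>2 + e\<^sup>2"
    using mu_plus_props(1)[OF assms, of "- v" \<eta>] C
    by (simp add: m_def mu_minus_eq_mu_plus e_def z_def M_def C_def diff_divide_distrib)
  have "Re (p + m) > 0"
    using mu_plus_props(2)[OF assms, of v \<eta>] mu_plus_props(2)[OF assms, of "- v" \<eta>]
    by (simp add: p_def m_def mu_minus_eq_mu_plus)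
  then have pm: "p + m \<noteq> 0" by (metis less_irrefl zero_complex.sel(1))
  have diff: "p\<^sup>2 - m\<^sup>2 = 4 * \<i> * M * z * e"
    unfolding p m by (simp add: power2_eq_square algebra_simps)
  have sum: "p\<^sup>2 + m\<^sup>2 = 2 * (z\<^sup>2 - M\<^sup>2 * e\<^sup>2 + e\<^sup>2)"
    unfolding p m by (simp add: power2_eq_square algebra_simps)
  have "(p\<^sup>2 - m\<^sup>2)\<^sup>2 = - 16 * M\<^sup>2 * z\<^sup>2 * e\<^sup>2"
    unfolding diff by (simp add: power_mult_distrib)
  then have "(z\<^sup>2 - M\<^sup>2 * e\<^sup>2) * (p + m)\<^sup>2 + 8 * M\<^sup>2 * e\<^sup>2 * z\<^sup>2 = (p * m - e\<^sup>2) * (p + m)\<^sup>2"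
    using sum by algebra
  then have "z\<^sup>2 + M\<^sup>2 * e\<^sup>2 * (8 * (z / (p + m))\<^sup>2 - 1) = p * m - e\<^sup>2"
    using pm by (simp add: field_simps)
  then have "C\<^sup>2 * (z\<^sup>2 + M\<^sup>2 * e\<^sup>2 * (8 * (z / (p + m))\<^sup>2 - 1)) = C\<^sup>2 * (p * m - e\<^sup>2)"
    by (rule arg_cong)
  \<comment> \<open>The unreduced quotient \<open>C * z / C\<close> keeps the shape of
    \<open>\<tau> / of_real c\<close> in the definition of the symbol.\<close>
  then have "(C * z)\<^sup>2 + (C * M)\<^sup>2 * e\<^sup>2 * (8 * (C * z / C / (p + m))\<^sup>2 - 1) = C\<^sup>2 * (p * m - e\<^sup>2)"
    using C by (simp add: power_mult_distrib distrib_left mult.assoc)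
  then show ?thesis
    unfolding Sigma_symbol_def using \<tau> v by (simp add: p_def m_def e_def C_def)
qed

section \<open>Lower bounds for quadratic factors\<close>

text \<open>One factor is at least \<open>S / 2\<close> and the other at least \<open>m\<close>.
  This serves twice: for the linear factors of a quadratic, then for the two quadratics.\<close>

lemma mult_ge_of_sum_ge:
  fixes x y m S :: real
  assumes "m \<ge> 0" "x \<ge> m" "y \<ge> m" "x + y \<ge> S"
  shows "m * S \<le> 2 * (x * y)"
proof -
  have "m * S \<le> m * (x + y)" using assms by (intro mult_left_mono) auto
  also have "\<dots> = m * x + m * y" by (rule distrib_left)
  also have "\<dots> \<le> y * x + x * y"
    using assms by (intro add_mono mult_right_mono) auto
  finally show ?thesis by simp
qed

text \<open>The linear factors \<open>z - w\<close> and \<open>z + w\<close>, with \<open>w\<close>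
  imaginary, each have modulus at least \<open>Re z\<close>. Their sum and difference control
  \<open>norm z\<close> and \<open>a * \<bar>\<eta>\<bar>\<close>, so they cannot both be
  small.\<close>

lemma norm_square_plus_ge:
  fixes z :: complex and a \<eta> :: real
  assumes "Re z \<ge> 0" "a > 0"
  shows "Re z * (min 1 a * (norm z + \<bar>\<eta>\<bar>)) \<le> 2 * norm (z\<^sup>2 + (of_real (a * \<eta>))\<^sup>2)"
proof -
  define w where "w = \<i> * of_real (a * \<eta>)"
  have fact: "z\<^sup>2 + (of_real (a * \<eta>))\<^sup>2 = (z - w) * (z + w)"
    by (simp add: w_def power2_eq_square algebra_simps)
  have "norm ((z - w) + (z + w)) \<le> norm (z - w) + norm (z + w)" by (rule norm_triangle_ineq)
  then have 1: "2 * norm z \<le> norm (z - w) + norm (z + w)" by (simp add: norm_mult)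
  have "norm ((z + w) - (z - w)) \<le> norm (z + w) + norm (z - w)" by (rule norm_triangle_ineq4)
  then have 2: "2 * (a * \<bar>\<eta>\<bar>) \<le> norm (z - w) + norm (z + w)"
    using assms by (simp add: w_def norm_mult abs_mult mult_ac add.commute)
  have "min 1 a * (norm z + \<bar>\<eta>\<bar>) \<le> 1 * norm z + a * \<bar>\<eta>\<bar>"
    unfolding distrib_left by (intro add_mono mult_right_mono) auto
  also have "\<dots> \<le> norm (z - w) + norm (z + w)" using 1 2 by linarith
  finally have "min 1 a * (norm z + \<bar>\<eta>\<bar>) \<le> norm (z - w) + norm (z + w)" .
  moreover have "Re z \<le> norm (z - w)" "Re z \<le> norm (z + w)"
    using complex_Re_le_cmod[of "z - w"] complex_Re_le_cmod[of "z + w"] by (simp_all add: w_def)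
  ultimately show ?thesis
    unfolding fact norm_mult using assms by (intro mult_ge_of_sum_ge) auto
qed

text \<open>Subtracting the quadratics cancels \<open>z\<^sup>2\<close> and leaves
  \<open>(b\<^sup>2 - a\<^sup>2) * \<eta>\<^sup>2\<close>, which controls \<eta>; the first
  quadratic then controls \<open>z\<close>. Distinctness of \<open>a\<close> and \<open>b\<close>
  enters here.\<close>

lemma norm_square_plus_sum_ge:
  fixes a b :: real
  assumes "0 < a" "a < b"
  shows "\<exists>k>0. \<forall>z :: complex. \<forall>\<eta> :: real. k * (norm z + \<bar>\<eta>\<bar>)\<^sup>2
           \<le> norm (z\<^sup>2 + (of_real (a * \<eta>))\<^sup>2) + norm (z\<^sup>2 + (of_real (b * \<eta>))\<^sup>2)"
proof -
  define d where "d = b\<^sup>2 - a\<^sup>2"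
  have d: "d > 0" using assms by (simp add: d_def power_strict_mono)
  \<comment> \<open>The 1 and \<open>a\<^sup>2 / d\<close> come from bounding
    \<open>(norm z)\<^sup>2\<close>, the \<open>1 / d\<close> from bounding
    \<open>\<eta>\<^sup>2\<close>. The later factor 2 comes from squaring the sum
    \<open>norm z + \<bar>\<eta>\<bar>\<close>.\<close>
  define K where "K = 1 + (a\<^sup>2 + 1) / d"
  have K: "K > 0" using d by (simp add: K_def add_pos_nonneg)
  have "1 / (2 * K) * (norm z + \<bar>\<eta>\<bar>)\<^sup>2
      \<le> norm (z\<^sup>2 + (of_real (a * \<eta>))\<^sup>2) + norm (z\<^sup>2 + (of_real (b * \<eta>))\<^sup>2)"
    (is "_ \<le> ?A + ?B") for z :: complex and \<eta> :: real
  proof -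
    have "norm (complex_of_real (d * \<eta>\<^sup>2)) = norm ((z\<^sup>2 + (of_real (b * \<eta>))\<^sup>2) - (z\<^sup>2 + (of_real (a * \<eta>))\<^sup>2))"
      by (rule arg_cong[of _ _ norm]) (simp add: d_def algebra_simps)
    also have "\<dots> \<le> ?B + ?A" by (rule norm_triangle_ineq4)
    finally have "d * \<eta>\<^sup>2 \<le> ?A + ?B" using d by (simp add: norm_mult norm_power)
    then have "\<eta>\<^sup>2 \<le> (?A + ?B) / d" using d by (simp add: field_simps)
    then have 1: "(a\<^sup>2 + 1) * \<eta>\<^sup>2 \<le> (a\<^sup>2 + 1) * ((?A + ?B) / d)" by (intro mult_left_mono) auto
    have "norm ((z\<^sup>2 + (of_real (a * \<eta>))\<^sup>2) - (of_real (a * \<eta>))\<^sup>2) \<le> ?A + norm ((complex_of_real (a * \<eta>))\<^sup>2)"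
      by (rule norm_triangle_ineq4)
    then have "(norm z)\<^sup>2 \<le> ?A + a\<^sup>2 * \<eta>\<^sup>2"
      by (simp add: norm_power norm_mult power_mult_distrib)
    then have "(norm z)\<^sup>2 \<le> ?A + ?B + a\<^sup>2 * \<eta>\<^sup>2"
      by (smt (verit) norm_ge_zero)
    moreover have "(a\<^sup>2 + 1) * \<eta>\<^sup>2 = a\<^sup>2 * \<eta>\<^sup>2 + \<eta>\<^sup>2" by (simp only: distrib_right mult_1)
    moreover have "K * (?A + ?B) = (?A + ?B) + (a\<^sup>2 + 1) * ((?A + ?B) / d)"
      unfolding K_def distrib_right[of 1] by simp
    ultimately have "(norm z)\<^sup>2 + \<eta>\<^sup>2 \<le> K * (?A + ?B)"
      using 1 by linarith
    moreover have "(norm z + \<bar>\<eta>\<bar>)\<^sup>2 \<le> 2 * ((norm z)\<^sup>2 + \<eta>\<^sup>2)"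
      using sum_squares_bound[of "norm z" "\<bar>\<eta>\<bar>"] by (simp add: power2_sum)
    ultimately have "(norm z + \<bar>\<eta>\<bar>)\<^sup>2 \<le> 2 * (K * (?A + ?B))" by (meson order_trans mult_left_mono zero_le_numeral)
    then have "(norm z + \<bar>\<eta>\<bar>)\<^sup>2 \<le> (2 * K) * (?A + ?B)" by (simp only: mult.assoc)
    then show ?thesis using K by (simp add: pos_divide_le_eq mult.commute)
  qed
  then show ?thesis using K by (intro exI[of _ "1 / (2 * K)"]) auto
qed

section \<open>Lower bound for the symbol\<close>

text \<open>This linear growth makes the conjugate factor at most quadratic. The constant 2 absorbs
  the summand \<open>\<eta>\<^sup>2\<close>, since
  \<open>(1 + M)\<^sup>2 + 1 \<le> (2 + M)\<^sup>2\<close>.\<close>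

lemma norm_mu_plus_le:
  assumes "Re \<tau> > 0" "c > 0"
  shows "norm (mu_plus v c \<tau> \<eta>) \<le> (2 + \<bar>v / c\<bar>) * (norm (\<tau> / of_real c) + \<bar>\<eta>\<bar>)"
proof (rule power2_le_imp_le)
  define z M where "z = \<tau> / of_real c" and "M = \<bar>v / c\<bar>"
  have M: "M \<ge> 0" by (simp add: M_def)
  have "norm ((\<tau> + \<i> * of_real v * of_real \<eta>) / of_real c) = norm (z + \<i> * of_real (v / c) * of_real \<eta>)"
    by (simp add: z_def add_divide_distrib)
  also have "\<dots> \<le> norm z + norm (\<i> * of_real (v / c) * of_real \<eta>)" by (rule norm_triangle_ineq)
  also have "\<dots> = norm z + M * \<bar>\<eta>\<bar>"
    by (simp add: norm_mult M_def norm_divide)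
  also have "\<dots> \<le> (1 + M) * (norm z + \<bar>\<eta>\<bar>)"
    using M by (simp add: algebra_simps)
  finally have 1: "norm ((\<tau> + \<i> * of_real v * of_real \<eta>) / of_real c) \<le> (1 + M) * (norm z + \<bar>\<eta>\<bar>)" .
  have "(norm (mu_plus v c \<tau> \<eta>))\<^sup>2 = norm (((\<tau> + \<i> * of_real v * of_real \<eta>) / of_real c)\<^sup>2 + (of_real \<eta>)\<^sup>2)"
    using mu_plus_props(1)[OF assms] by (simp flip: norm_power)
  also have "\<dots> \<le> (norm ((\<tau> + \<i> * of_real v * of_real \<eta>) / of_real c))\<^sup>2 + \<bar>\<eta>\<bar>\<^sup>2"
    by (rule order_trans[OF norm_triangle_ineq]) (simp only: norm_power norm_of_real order_refl)
  also have "\<dots> \<le> ((1 + M) * (norm z + \<bar>\<eta>\<bar>))\<^sup>2 + (norm z + \<bar>\<eta>\<bar>)\<^sup>2"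
    using 1 by (intro add_mono power_mono) auto
  also have "\<dots> = ((1 + M)\<^sup>2 + 1) * (norm z + \<bar>\<eta>\<bar>)\<^sup>2"
    unfolding power_mult_distrib distrib_right[of _ 1] by simp
  also have "\<dots> \<le> (2 + M)\<^sup>2 * (norm z + \<bar>\<eta>\<bar>)\<^sup>2"
    using M by (intro mult_right_mono) (auto simp: power2_eq_square algebra_simps)
  finally show "(norm (mu_plus v c \<tau> \<eta>))\<^sup>2 \<le> ((2 + \<bar>v / c\<bar>) * (norm (\<tau> / of_real c) + \<bar>\<eta>\<bar>))\<^sup>2"
    by (simp add: power_mult_distrib z_def M_def)
qed simp

text \<open>The left side is a quadratic in \<open>z\<^sup>2\<close>, so only the sum and product of
  \<open>a\<^sup>2\<close> and \<open>b\<^sup>2\<close> need matching. Their product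
  \<open>M\<^sup>2 * (M\<^sup>2 - 2)\<close> is positive exactly because \<open>M > sqrt 2\<close>,
  which keeps \<open>a\<close> real and nonzero.\<close>

lemma quartic_factorization:
  fixes M :: real
  assumes "M > sqrt 2"
  obtains a b where "0 < a" "a < b"
    "\<And>z e :: complex. ((z + \<i> * of_real M * e)\<^sup>2 + e\<^sup>2) * ((z - \<i> * of_real M * e)\<^sup>2 + e\<^sup>2) - e ^ 4
       = (z\<^sup>2 + (of_real a * e)\<^sup>2) * (z\<^sup>2 + (of_real b * e)\<^sup>2)"
proof -
  define r where "r = sqrt (4 * M\<^sup>2 + 1)"
  have r: "r > 0" "r\<^sup>2 = 4 * M\<^sup>2 + 1" by (auto simp: r_def add_nonneg_pos)
  have M2: "M\<^sup>2 > 2"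
    using power_strict_mono[OF assms, of 2] by simp
  have "r\<^sup>2 < (M\<^sup>2 + 1)\<^sup>2"
  proof -
    have "0 < M\<^sup>2 * (M\<^sup>2 - 2)" using M2 by (intro mult_pos_pos) auto
    then show ?thesis unfolding r(2) by (simp add: power2_eq_square algebra_simps)
  qed
  then have rM: "r < M\<^sup>2 + 1" by (rule power2_less_imp_less) simp
  define a b where "a = sqrt (M\<^sup>2 + 1 - r)" and "b = sqrt (M\<^sup>2 + 1 + r)"
  have ab: "a\<^sup>2 = M\<^sup>2 + 1 - r" "b\<^sup>2 = M\<^sup>2 + 1 + r"
    using rM r by (simp_all add: a_def b_def)
  have sum: "a\<^sup>2 + b\<^sup>2 = 2 * (M\<^sup>2 + 1)" using ab by simp
  have prod: "a\<^sup>2 * b\<^sup>2 = M\<^sup>2 * (M\<^sup>2 - 2)" using ab r(2) by algebra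
  show ?thesis
  proof (rule that[of a b])
    show "0 < a" using rM by (simp add: a_def)
    show "a < b" using r by (simp add: a_def b_def)
    fix z e :: complex
    define A B N where "A = complex_of_real a" and "B = complex_of_real b" and "N = complex_of_real M"
    have "A\<^sup>2 + B\<^sup>2 = 2 * (N\<^sup>2 + 1)" using arg_cong[OF sum, of complex_of_real]
      by (simp add: A_def B_def N_def)
    moreover have "A\<^sup>2 * B\<^sup>2 = N\<^sup>2 * (N\<^sup>2 - 2)" using arg_cong[OF prod, of complex_of_real]
      by (simp add: A_def B_def N_def)
    \<comment> \<open>For \<open>algebra\<close> the imaginary unit is an indeterminate, so its
      square is supplied as a relation.\<close>
    moreover have "\<i>\<^sup>2 = -1" by simp
    ultimately have "((z + \<i> * N * e)\<^sup>2 + e\<^sup>2) * ((z - \<i> * N * e)\<^sup>2 + e\<^sup>2) - e ^ 4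
       = (z\<^sup>2 + (A * e)\<^sup>2) * (z\<^sup>2 + (B * e)\<^sup>2)" by algebra
    then show "((z + \<i> * of_real M * e)\<^sup>2 + e\<^sup>2) * ((z - \<i> * of_real M * e)\<^sup>2 + e\<^sup>2) - e ^ 4
       = (z\<^sup>2 + (of_real a * e)\<^sup>2) * (z\<^sup>2 + (of_real b * e)\<^sup>2)"
      unfolding A_def B_def N_def .
  qed
qed

lemma Sigma_symbol_lower_bound:
  fixes v c :: real
  assumes c: "c > 0" and M: "v / c > sqrt 2"
  shows "\<exists>k>0. \<forall>\<tau> \<eta>. Re \<tau> > 0 \<longrightarrow> k * (Re \<tau> * (norm \<tau> + \<bar>\<eta>\<bar>)) \<le> norm (Sigma_symbol v c \<tau> \<eta>)"
proof -
  define M where "M = v / c"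
  obtain a b where ab: "0 < a" "a < b" and fact:
    "\<And>z e :: complex. ((z + \<i> * of_real M * e)\<^sup>2 + e\<^sup>2) * ((z - \<i> * of_real M * e)\<^sup>2 + e\<^sup>2) - e ^ 4
       = (z\<^sup>2 + (of_real a * e)\<^sup>2) * (z\<^sup>2 + (of_real b * e)\<^sup>2)"
    using quartic_factorization[of M] M unfolding M_def by metis
  obtain k where k: "k > 0" and sum: "\<And>(z :: complex) (\<eta> :: real). k * (norm z + \<bar>\<eta>\<bar>)\<^sup>2
           \<le> norm (z\<^sup>2 + (of_real (a * \<eta>))\<^sup>2) + norm (z\<^sup>2 + (of_real (b * \<eta>))\<^sup>2)"
    using norm_square_plus_sum_ge[OF ab] by blast
  \<comment> \<open>As \<open>a < b\<close>, the constant built from \<open>a\<close> serves both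
    quadratics.\<close>
  define l where "l = min 1 a / 2"
  have l: "l > 0" using ab by (simp add: l_def)
  define K where "K = (2 + \<bar>v / c\<bar>)\<^sup>2 + 1"
  have K: "K > 0" by (simp add: K_def add_nonneg_pos)
  \<comment> \<open>The factors stem from the reduced symbol (\<open>c\<^sup>2\<close>), the product
    estimate (\<open>l * k / (2 * K)\<close>), \<open>Re z = Re \<tau> / c\<close>, and the
    comparison of \<open>norm z + \<bar>\<eta>\<bar>\<close> with
    \<open>norm \<tau> + \<bar>\<eta>\<bar>\<close>.\<close>
  define q where "q = c\<^sup>2 * (l * k / (2 * K)) * (1 / c * min (1 / c) 1)"
  have q: "q > 0" using c l k K by (simp add: q_def)
  have "q * (Re \<tau> * (norm \<tau> + \<bar>\<eta>\<bar>)) \<le> norm (Sigma_symbol v c \<tau> \<eta>)" if \<tau>: "Re \<tau> > 0" for \<tau> \<eta>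
  proof -
    define z e p m L where "z = \<tau> / of_real c" and "e = (of_real \<eta> :: complex)"
      and "p = mu_plus v c \<tau> \<eta>" and "m = mu_minus v c \<tau> \<eta>" and "L = norm z + \<bar>\<eta>\<bar>"
    have Rz: "Re z = Re \<tau> / c" by (simp add: z_def Re_divide_of_real)
    have z: "Re z > 0" using \<tau> c Rz by simp
    then have L: "L > 0" unfolding L_def using complex_Re_le_cmod[of z] by linarith
    have p2: "p\<^sup>2 = (z + \<i> * of_real M * e)\<^sup>2 + e\<^sup>2"
      using mu_plus_props(1)[OF \<tau> c, of v \<eta>]
      by (simp add: p_def e_def z_def M_def add_divide_distrib)
    have m2: "m\<^sup>2 = (z - \<i> * of_real M * e)\<^sup>2 + e\<^sup>2"
      using mu_plus_props(1)[OF \<tau> c, of "- v" \<eta>]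
      by (simp add: m_def mu_minus_eq_mu_plus e_def z_def M_def diff_divide_distrib)
    have "(p * m - e\<^sup>2) * (p * m + e\<^sup>2) = p\<^sup>2 * m\<^sup>2 - e ^ 4" by algebra
    also have "\<dots> = (z\<^sup>2 + (of_real (a * \<eta>))\<^sup>2) * (z\<^sup>2 + (of_real (b * \<eta>))\<^sup>2)"
      unfolding p2 m2 fact by (simp add: e_def)
    finally have prod: "norm (p * m - e\<^sup>2) * norm (p * m + e\<^sup>2)
        = norm (z\<^sup>2 + (of_real (a * \<eta>))\<^sup>2) * norm (z\<^sup>2 + (of_real (b * \<eta>))\<^sup>2)"
      by (metis norm_mult)
    have "norm (p * m + e\<^sup>2) \<le> norm p * norm m + \<bar>\<eta>\<bar>\<^sup>2"
      by (rule order_trans[OF norm_triangle_ineq])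
        (simp only: norm_power norm_mult norm_of_real e_def order_refl)
    also have "\<dots> \<le> ((2 + \<bar>v / c\<bar>) * L) * ((2 + \<bar>v / c\<bar>) * L) + L\<^sup>2"
      using norm_mu_plus_le[OF \<tau> c, of v \<eta>] norm_mu_plus_le[OF \<tau> c, of "- v" \<eta>] L
      by (intro add_mono mult_mono power_mono)
        (auto simp: p_def m_def mu_minus_eq_mu_plus L_def z_def)
    also have "\<dots> = K * L\<^sup>2" by (simp add: K_def power2_eq_square algebra_simps)
    finally have upper: "norm (p * m + e\<^sup>2) \<le> K * L\<^sup>2" .
    have A: "l * Re z * L \<le> norm (z\<^sup>2 + (of_real (a * \<eta>))\<^sup>2)"
      using norm_square_plus_ge[of z a \<eta>] z ab by (simp add: l_def L_def mult.commute mult.left_commute)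
    have "l * Re z * L \<le> min 1 b / 2 * Re z * L"
      using z L ab by (intro mult_right_mono) (auto simp: l_def)
    also have "\<dots> \<le> norm (z\<^sup>2 + (of_real (b * \<eta>))\<^sup>2)"
      using norm_square_plus_ge[of z b \<eta>] z ab by (simp add: L_def mult.commute mult.left_commute)
    finally have B: "l * Re z * L \<le> norm (z\<^sup>2 + (of_real (b * \<eta>))\<^sup>2)" .
    \<comment> \<open>Each quadratic is at least \<open>l * Re z * L\<close> and their sum at least
      \<open>k * L\<^sup>2\<close>; the conjugate factor then costs
      \<open>K * L\<^sup>2\<close>.\<close>
    have "(l * Re z * L) * (k * L\<^sup>2) \<le> 2 * (norm (p * m - e\<^sup>2) * norm (p * m + e\<^sup>2))"
      unfolding prod using A B sum[of z \<eta>] l z L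
      by (intro mult_ge_of_sum_ge) (auto simp: L_def)
    also have "\<dots> \<le> 2 * (norm (p * m - e\<^sup>2) * (K * L\<^sup>2))"
      using upper by (intro mult_left_mono) auto
    finally have "(l * k * (Re z * L)) * L\<^sup>2 \<le> (2 * K * norm (p * m - e\<^sup>2)) * L\<^sup>2"
      by (simp add: mult_ac)
    then have "l * k * (Re z * L) \<le> 2 * K * norm (p * m - e\<^sup>2)"
      using L by (simp add: mult_le_cancel_right)
    then have lower: "l * k / (2 * K) * (Re z * L) \<le> norm (p * m - e\<^sup>2)"
      using K by (simp add: field_simps)
    have "min (1 / c) 1 * (norm \<tau> + \<bar>\<eta>\<bar>) \<le> 1 / c * norm \<tau> + 1 * \<bar>\<eta>\<bar>"
      unfolding distrib_left by (intro add_mono mult_right_mono) auto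
    also have "\<dots> = L" using c by (simp add: L_def z_def norm_divide)
    finally have "Re z * (min (1 / c) 1 * (norm \<tau> + \<bar>\<eta>\<bar>)) \<le> Re z * L"
      using z by (intro mult_left_mono) auto
    then have "c\<^sup>2 * (l * k / (2 * K) * (Re z * (min (1 / c) 1 * (norm \<tau> + \<bar>\<eta>\<bar>))))
        \<le> c\<^sup>2 * (l * k / (2 * K) * (Re z * L))"
      by (rule mult_left_mono[OF mult_left_mono]) (use l k K in auto)
    also have "\<dots> \<le> c\<^sup>2 * norm (p * m - e\<^sup>2)"
      using lower by (intro mult_left_mono) auto
    also have "\<dots> = norm (Sigma_symbol v c \<tau> \<eta>)"
      unfolding Sigma_symbol_eq[OF \<tau> c] by (simp add: norm_mult norm_power p_def m_def e_def)
    finally show ?thesis by (simp add: q_def Rz mult_ac)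
  qed
  with q show ?thesis by blast
qed

section \<open>From the symbol to the weighted norms\<close>

text \<open>For fixed \<gamma> the ratio of the two weight bases lies between 1 and
  \<open>\<gamma>\<^sup>2\<close>. The resulting bound depends on \<gamma>, which is harmless as
  only integrability is claimed.\<close>

lemma integrable_gamma_weight:
  fixes h :: "real \<times> real \<Rightarrow> complex" and s \<gamma> :: real
  assumes \<gamma>: "\<gamma> \<ge> 1"
    and int: "integrable lborel (\<lambda>\<xi>. (1 + (norm \<xi>)\<^sup>2) powr s * (norm (h \<xi>))\<^sup>2)"
  shows "integrable lborel (\<lambda>\<xi>. (\<gamma>\<^sup>2 + (norm \<xi>)\<^sup>2) powr s * (norm (h \<xi>))\<^sup>2)"
proof -
  have pos: "1 + (norm \<xi>)\<^sup>2 > 0" for \<xi> :: "real \<times> real"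
    by (simp add: add_pos_nonneg)
  define \<rho> where "\<rho> = (\<lambda>\<xi> :: real \<times> real. ((\<gamma>\<^sup>2 + (norm \<xi>)\<^sup>2) / (1 + (norm \<xi>)\<^sup>2)) powr s)"
  have \<rho>: "\<bar>\<rho> \<xi>\<bar> \<le> (\<gamma>\<^sup>2) powr \<bar>s\<bar>" for \<xi>
  proof -
    let ?x = "(\<gamma>\<^sup>2 + (norm \<xi>)\<^sup>2) / (1 + (norm \<xi>)\<^sup>2)"
    have g: "\<gamma>\<^sup>2 \<ge> 1" using \<gamma> by simp
    have 1: "1 \<le> ?x" using g pos[of \<xi>] by (simp add: pos_le_divide_eq)
    have "(\<gamma>\<^sup>2 - 1) * (norm \<xi>)\<^sup>2 \<ge> 0" using g by (intro mult_nonneg_nonneg) auto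
    then have 2: "?x \<le> \<gamma>\<^sup>2" using pos[of \<xi>] by (simp add: pos_divide_le_eq algebra_simps)
    \<comment> \<open>The base is at least 1, so passing to \<open>\<bar>s\<bar>\<close> treats both
      signs of \<open>s\<close> at once.\<close>
    have "\<bar>\<rho> \<xi>\<bar> \<le> ?x powr \<bar>s\<bar>" using 1 by (simp add: \<rho>_def powr_mono)
    also have "\<dots> \<le> (\<gamma>\<^sup>2) powr \<bar>s\<bar>" using 1 2 by (intro powr_mono2) auto
    finally show ?thesis .
  qed
  have "integrable lborel (\<lambda>\<xi>. \<rho> \<xi> * ((1 + (norm \<xi>)\<^sup>2) powr s * (norm (h \<xi>))\<^sup>2))"
  proof (rule Bochner_Integration.integrable_bound)
    show "integrable lborel (\<lambda>\<xi>. (\<gamma>\<^sup>2) powr \<bar>s\<bar> * ((1 + (norm \<xi>)\<^sup>2) powr s * (norm (h \<xi>))\<^sup>2))"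
      using int by (rule integrable_mult_right)
    have "\<rho> \<in> borel_measurable lborel" unfolding \<rho>_def by measurable
    moreover have "(\<lambda>\<xi>. (1 + (norm \<xi>)\<^sup>2) powr s * (norm (h \<xi>))\<^sup>2) \<in> borel_measurable lborel"
      using int by (rule borel_measurable_integrable)
    ultimately show "(\<lambda>\<xi>. \<rho> \<xi> * ((1 + (norm \<xi>)\<^sup>2) powr s * (norm (h \<xi>))\<^sup>2)) \<in> borel_measurable lborel"
      by (rule borel_measurable_times)
    show "AE \<xi> in lborel. norm (\<rho> \<xi> * ((1 + (norm \<xi>)\<^sup>2) powr s * (norm (h \<xi>))\<^sup>2))
        \<le> norm ((\<gamma>\<^sup>2) powr \<bar>s\<bar> * ((1 + (norm \<xi>)\<^sup>2) powr s * (norm (h \<xi>))\<^sup>2))"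
      using \<rho> by (intro AE_I2) (auto simp: abs_mult intro!: mult_right_mono)
  qed
  moreover have "\<rho> \<xi> * ((1 + (norm \<xi>)\<^sup>2) powr s * (norm (h \<xi>))\<^sup>2)
      = (\<gamma>\<^sup>2 + (norm \<xi>)\<^sup>2) powr s * (norm (h \<xi>))\<^sup>2" for \<xi>
    using pos[of \<xi>] by (simp add: \<rho>_def powr_divide)
  ultimately show ?thesis by simp
qed

lemma H_gamma_norm_eq:
  "H_gamma_norm s \<gamma> u = sqrt (1 / (2 * pi)\<^sup>2 *
     (LINT \<xi>|lborel. (\<gamma>\<^sup>2 + (norm \<xi>)\<^sup>2) powr s * (norm (weighted_hat \<gamma> u \<xi>))\<^sup>2))"
proof -
  have "(norm \<xi>)\<^sup>2 = (fst \<xi>)\<^sup>2 + (snd \<xi>)\<^sup>2" for \<xi> :: "real \<times> real"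
    by (simp add: norm_prod_def)
  then show ?thesis
    by (simp add: H_gamma_norm_def norm_s_gamma_def weighted_hat_def case_prod_unfold add.assoc)
qed

theorem theorem6p1:
  fixes v c s :: real
  assumes "v > 0" and "c > 0" and "v / c > sqrt 2"
  shows "\<exists>C>0. \<forall>\<gamma>\<ge>1. \<forall>f \<in> H_gamma (s + 2) \<gamma>. \<forall>g \<in> H_gamma s \<gamma>.
           (AE (\<delta>, \<eta>) in lborel.
              Sigma_symbol v c (Complex \<gamma> \<delta>) \<eta> * weighted_hat \<gamma> f (\<delta>, \<eta>) = weighted_hat \<gamma> g (\<delta>, \<eta>)) \<longrightarrow>
           \<gamma> * H_gamma_norm (s + 1) \<gamma> f \<le> C * H_gamma_norm s \<gamma> g"
proof -
  obtain k where k: "k > 0" and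
    lower: "\<And>\<tau> \<eta>. Re \<tau> > 0 \<Longrightarrow> k * (Re \<tau> * (norm \<tau> + \<bar>\<eta>\<bar>)) \<le> norm (Sigma_symbol v c \<tau> \<eta>)"
    using Sigma_symbol_lower_bound[OF assms(2,3)] by blast
  \<comment> \<open>The constant is the reciprocal of the symbol's lower constant \<open>k\<close>,
    hence uniform in \<gamma>, \<open>f\<close> and \<open>g\<close>.\<close>
  have "\<gamma> * H_gamma_norm (s + 1) \<gamma> f \<le> 1 / k * H_gamma_norm s \<gamma> g"
    if \<gamma>: "\<gamma> \<ge> 1" and g: "g \<in> H_gamma s \<gamma>"
      and eq: "AE (\<delta>, \<eta>) in lborel.
        Sigma_symbol v c (Complex \<gamma> \<delta>) \<eta> * weighted_hat \<gamma> f (\<delta>, \<eta>) = weighted_hat \<gamma> g (\<delta>, \<eta>)"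
    for \<gamma> f g
  proof -
    let ?F = "\<lambda>\<xi>. (\<gamma>\<^sup>2 + (norm \<xi>)\<^sup>2) powr (s + 1) * (norm (weighted_hat \<gamma> f \<xi>))\<^sup>2"
    let ?G = "\<lambda>\<xi>. (\<gamma>\<^sup>2 + (norm \<xi>)\<^sup>2) powr s * (norm (weighted_hat \<gamma> g \<xi>))\<^sup>2"
    have int: "integrable lborel ?G"
      using g by (intro integrable_gamma_weight[OF \<gamma>])
        (simp add: H_gamma_def sobolev_def weighted_hat_def)
    have "AE \<xi> in lborel. (k * \<gamma>)\<^sup>2 * ?F \<xi> \<le> ?G \<xi>"
      using eq
    proof eventually_elim
      fix \<xi> :: "real \<times> real"
      obtain \<delta> \<eta> where \<xi>: "\<xi> = (\<delta>, \<eta>)" by force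
      assume "case \<xi> of (\<delta>, \<eta>) \<Rightarrow>
        Sigma_symbol v c (Complex \<gamma> \<delta>) \<eta> * weighted_hat \<gamma> f (\<delta>, \<eta>) = weighted_hat \<gamma> g (\<delta>, \<eta>)"
      then have *: "norm (weighted_hat \<gamma> g \<xi>) =
          norm (Sigma_symbol v c (Complex \<gamma> \<delta>) \<eta>) * norm (weighted_hat \<gamma> f \<xi>)"
        by (simp add: \<xi> flip: norm_mult)
      define S where "S = norm (Sigma_symbol v c (Complex \<gamma> \<delta>) \<eta>)"
      define W where "W = \<gamma>\<^sup>2 + (norm \<xi>)\<^sup>2"
      have W: "W > 0" using \<gamma> by (simp add: W_def add_pos_nonneg)
      have "W = (norm (Complex \<gamma> \<delta>))\<^sup>2 + \<bar>\<eta>\<bar>\<^sup>2"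
        by (simp add: W_def \<xi> norm_Pair cmod_power2)
      also have "\<dots> \<le> (norm (Complex \<gamma> \<delta>) + \<bar>\<eta>\<bar>)\<^sup>2" by (simp add: power2_sum del: power2_abs)
      finally have "(k * \<gamma>)\<^sup>2 * W \<le> (k * \<gamma>)\<^sup>2 * (norm (Complex \<gamma> \<delta>) + \<bar>\<eta>\<bar>)\<^sup>2"
        by (intro mult_left_mono) auto
      also have "\<dots> = (k * (\<gamma> * (norm (Complex \<gamma> \<delta>) + \<bar>\<eta>\<bar>)))\<^sup>2"
        by (simp add: power_mult_distrib mult.assoc)
      also have "\<dots> \<le> S\<^sup>2"
        using lower[of "Complex \<gamma> \<delta>" \<eta>] \<gamma> k unfolding S_def by (intro power_mono) auto
      \<comment> \<open>The extra factor \<open>W\<close>, bounded through the symbol, raises the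
        weight exponent from \<open>s\<close> to \<open>s + 1\<close>.\<close>
      finally have "((k * \<gamma>)\<^sup>2 * W) * (W powr s * (norm (weighted_hat \<gamma> f \<xi>))\<^sup>2)
          \<le> S\<^sup>2 * (W powr s * (norm (weighted_hat \<gamma> f \<xi>))\<^sup>2)"
        by (intro mult_right_mono) auto
      then show "(k * \<gamma>)\<^sup>2 * ?F \<xi> \<le> ?G \<xi>"
        unfolding * using W
        by (simp add: powr_add power_mult_distrib mult_ac flip: S_def W_def)
    qed
    \<comment> \<open>The dominating integrand \<open>?G\<close> is nonnegative and, by
      \<open>int\<close>, integrable.\<close>
    then have "(LINT \<xi>|lborel. (k * \<gamma>)\<^sup>2 * ?F \<xi>) \<le> (LINT \<xi>|lborel. ?G \<xi>)"
      using int by (intro integral_mono_AE') auto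
    then have "(k * \<gamma>)\<^sup>2 * (LINT \<xi>|lborel. ?F \<xi>) \<le> (LINT \<xi>|lborel. ?G \<xi>)"
      by simp
    then have "sqrt (1 / (2 * pi)\<^sup>2 * ((k * \<gamma>)\<^sup>2 * (LINT \<xi>|lborel. ?F \<xi>)))
        \<le> sqrt (1 / (2 * pi)\<^sup>2 * (LINT \<xi>|lborel. ?G \<xi>))"
      by (intro real_sqrt_le_mono mult_left_mono) auto
    then have "k * \<gamma> * H_gamma_norm (s + 1) \<gamma> f \<le> H_gamma_norm s \<gamma> g"
      using k \<gamma> unfolding H_gamma_norm_eq by (simp add: real_sqrt_mult real_sqrt_divide abs_mult)
    then show ?thesis using k by (simp add: field_simps)
  qed
  then show ?thesis using k by (intro exI[of _ "1 / k"]) auto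
qed

end
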